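(* Let $W(E_8^{(1)})=\langle w_0,w_1,\dots,w_8\rangle$ act on the parameters $u_1,\dots,u_8,b$ as described in the context, and let $\Omega$ be the set of all $\rho\in W(E_8^{(1)})$ such that $$\rho(u_1)=\rho(u_2),\quad \rho(u_3)=\rho(u_4),\quad \rho(u_5)=\rho(u_6),\quad \rho(u_7)=\rho(u_8)$$ hold under the condition $$u_1=u_2,\quad u_3=u_4,\quad u_5=u_6,\quad u_7=u_8 .$$ Then $$\Omega=\langle w_0,w_1,w_2,r_1,w_4,r_2,w_6,r_3,w_8\rangle,$$ where $r_1=w_3w_4w_8w_3$, $r_2=w_5w_4w_6w_5$, $r_3=w_7w_6w_0w_7$.
   Context: $W(E_8^{(1)})=\langle w_0,\dots,w_8\rangle$ is the affine Weyl group of type $E_8^{(1)}$, with relations $w_i^2=1$ for all $i$; $(w_iw_{i+1})^3=1$ for $i=1,\dots,6$; $(w_0w_7)^3=1$; $(w_3w_8)^3=1$; and $(w_iw_j)^2=1$ for all other pairs $i\neq j$. It acts from the left, linearly, on the span of the independent parameters $u_1,\dots,u_8,b$ (with $(xy)(h)=x(y(h))$) by (anything not listed is fixed): - $w_1: b\mapsto -b$; - $w_i:(u_{i-1},u_i)\mapsto(u_i,u_{i-1})$ for $i=3,\dots,7$; $w_0:(u_7,u_8)\mapsto(u_8,u_7)$; $w_8:(u_1,u_2)\mapsto(u_2,u_1)$; - $w_2(u_j)=u_j-\tfrac34(2b+u_1+u_2)$ for $j=1,2$; $w_2(u_j)=u_j+\tfrac14(2b+u_1+u_2)$ for $j=3,\dots,8$;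 $w_2(b)=b-\tfrac14(2b+u_1+u_2)$. Each $\rho(u_i)$ is a linear form in $u_1,\dots,u_8,b$; "under the condition" means that the stated equalities of linear forms are required after substituting $u_2=u_1$, $u_4=u_3$, $u_6=u_5$, $u_8=u_7$. *)

theory Defs
  imports "HOL-Analysis.Analysis" "HOL-Algebra.Generated_Groups"
begin

datatype gen = W0 | W1 | W2 | W3 | W4 | W5 | W6 | W7 | W8

definition bonds :: "(gen \<times> gen) set" where
  "bonds = {(W1, W2), (W2, W3), (W3, W4), (W4, W5), (W5, W6), (W6, W7), (W0, W7), (W3, W8)}"

definition cox_order :: "gen \<Rightarrow> gen \<Rightarrow> nat" where
  "cox_order i j = (if i = j then 1 else if (i, j) \<in> bonds \<or> (j, i) \<in> bonds then 3 else 2)"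

text \<open>
  The group is given by its presentation. Since the relations make every generator an involution,
  no letters for inverses are needed: the group is the quotient of the free monoid of words
  by the least congruence containing the relations $(w_i w_j)^{m(i,j)} = 1$, where
  $m(i,i) = 1$ encodes $w_i^2 = 1$.
\<close>

inductive cox_eq :: "gen list \<Rightarrow> gen list \<Rightarrow> bool" where
  refl: "cox_eq x x"
| sym: "cox_eq x y \<Longrightarrow> cox_eq y x"
| trans: "cox_eq x y \<Longrightarrow> cox_eq y z \<Longrightarrow> cox_eq x z"
| append: "cox_eq x x' \<Longrightarrow> cox_eq y y' \<Longrightarrow> cox_eq (x @ y) (x' @ y')"
| relation: "cox_eq (concat (replicate (cox_order i j) [i, j])) []"

quotient_type weyl = "gen list" / cox_eq
  by (intro equivpI reflpI sympI transpI) (blast intro: cox_eq.refl cox_eq.sym cox_eq.trans)+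

lift_definition weyl_mult :: "weyl \<Rightarrow> weyl \<Rightarrow> weyl" is "(@)"
  by (rule cox_eq.append)

lift_definition weyl_one :: weyl is "[]" .

lift_definition w :: "gen \<Rightarrow> weyl" is "\<lambda>i. [i]" .

definition WE8 :: "weyl monoid" where
  "WE8 = \<lparr>carrier = UNIV, mult = weyl_mult, one = weyl_one\<rparr>"

lemma cox_eq_rev_append: "cox_eq (rev x @ x) []"
proof (induction x)
  case Nil
  show ?case by (simp add: cox_eq.refl)
next
  case (Cons i x)
  have "cox_eq [i, i] []"
    using cox_eq.relation[of i i] by (simp add: cox_order_def)
  then have "cox_eq (rev x @ ([i, i] @ x)) (rev x @ ([] @ x))"
    by (intro cox_eq.append cox_eq.refl)
  with Cons.IH show ?case
    by (auto intro: cox_eq.trans)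
qed

lemma group_WE8: "group WE8"
proof (rule groupI)
  fix x y z assume "x \<in> carrier WE8" "y \<in> carrier WE8" "z \<in> carrier WE8"
  show "x \<otimes>\<^bsub>WE8\<^esub> y \<otimes>\<^bsub>WE8\<^esub> z = x \<otimes>\<^bsub>WE8\<^esub> (y \<otimes>\<^bsub>WE8\<^esub> z)"
    unfolding WE8_def by (simp, transfer, simp add: cox_eq.refl)
next
  fix x assume "x \<in> carrier WE8"
  show "\<one>\<^bsub>WE8\<^esub> \<otimes>\<^bsub>WE8\<^esub> x = x"
    unfolding WE8_def by (simp, transfer, simp add: cox_eq.refl)
  have "\<exists>y. weyl_mult y x = weyl_one"
    by transfer (blast intro: cox_eq_rev_append)
  then show "\<exists>y\<in>carrier WE8. y \<otimes>\<^bsub>WE8\<^esub> x = \<one>\<^bsub>WE8\<^esub>"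
    by (simp add: WE8_def)
qed (simp_all add: WE8_def)

datatype param = U1 | U2 | U3 | U4 | U5 | U6 | U7 | U8 | B

lemma UNIV_param: "UNIV = {U1, U2, U3, U4, U5, U6, U7, U8, B}"
proof -
  have "p \<in> {U1, U2, U3, U4, U5, U6, U7, U8, B}" for p
    by (cases p) auto
  then show ?thesis by blast
qed

instance param :: finite
  by standard (simp add: UNIV_param)

type_synonym form = "real ^ param"

text \<open>
  A linear form is its vector of coefficients: \<open>h $ p\<close> is the coefficient of the parameter \<open>p\<close>,
  and \<open>X p\<close> is the parameter \<open>p\<close> itself as a form.
\<close>

abbreviation X :: "param \<Rightarrow> form" where
  "X p \<equiv> axis p 1"

text \<open>The linear map on forms that sends each parameter \<open>p\<close> to \<open>g p\<close>.\<close>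

definition lin_ext :: "(param \<Rightarrow> form) \<Rightarrow> form \<Rightarrow> form" where
  "lin_ext g h = (\<Sum>p\<in>UNIV. (h $ p) *\<^sub>R g p)"

abbreviation beta :: form where
  "beta \<equiv> 2 *\<^sub>R X B + X U1 + X U2"

primrec gen_image :: "gen \<Rightarrow> param \<Rightarrow> form" where
  "gen_image W0 = X(U7 := X U8, U8 := X U7)"
| "gen_image W1 = X(B := - X B)"
| "gen_image W2 = (\<lambda>p. if p = U1 \<or> p = U2 then X p - (3/4) *\<^sub>R beta
                       else if p = B then X B - (1/4) *\<^sub>R beta
                       else X p + (1/4) *\<^sub>R beta)"
| "gen_image W3 = X(U2 := X U3, U3 := X U2)"
| "gen_image W4 = X(U3 := X U4, U4 := X U3)"
| "gen_image W5 = X(U4 := X U5, U5 := X U4)"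
| "gen_image W6 = X(U5 := X U6, U6 := X U5)"
| "gen_image W7 = X(U6 := X U7, U7 := X U6)"
| "gen_image W8 = X(U1 := X U2, U2 := X U1)"

definition gen_act :: "gen \<Rightarrow> form \<Rightarrow> form" where
  "gen_act i = lin_ext (gen_image i)"

definition word_act :: "gen list \<Rightarrow> form \<Rightarrow> form" where
  "word_act x h = foldr gen_act x h"

lemma linear_lin_ext: "linear (lin_ext g)"
  by (rule linearI)
    (simp_all add: lin_ext_def scaleR_add_left sum.distrib scaleR_sum_right)

lemma lin_ext_X [simp]: "lin_ext g (X p) = g p"
proof -
  have "lin_ext g (X p) = (\<Sum>q\<in>UNIV. if q = p then g p else 0)"
    unfolding lin_ext_def by (rule sum.cong) (auto simp: axis_def)
  then show ?thesis by simp
qed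

lemma lin_ext_nth:
  "lin_ext g h $ q = h$U1 * g U1 $ q + h$U2 * g U2 $ q + h$U3 * g U3 $ q + h$U4 * g U4 $ q
     + h$U5 * g U5 $ q + h$U6 * g U6 $ q + h$U7 * g U7 $ q + h$U8 * g U8 $ q + h$B * g B $ q"
  by (simp add: lin_ext_def UNIV_param)

lemma form_eqI:
  fixes h k :: form
  assumes "h$U1 = k$U1" "h$U2 = k$U2" "h$U3 = k$U3" "h$U4 = k$U4" "h$U5 = k$U5"
    "h$U6 = k$U6" "h$U7 = k$U7" "h$U8 = k$U8" "h$B = k$B"
  shows "h = k"
proof -
  have "h $ p = k $ p" for p using assms by (cases p) auto
  then show ?thesis by (simp add: vec_eq_iff)
qed

lemma gen_act_nth:
  "gen_act W0 h $ q = (if q = U7 then h $ U8 else if q = U8 then h $ U7 else h $ q)"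
  "gen_act W1 h $ q = (if q = B then - h $ B else h $ q)"
  "gen_act W2 h $ q = h $ q + (- 3 * h$U1 - 3 * h$U2 + h$U3 + h$U4 + h$U5 + h$U6 + h$U7 + h$U8 - h$B) / 4
       * (if q = B then 2 else if q = U1 \<or> q = U2 then 1 else 0)"
  "gen_act W3 h $ q = (if q = U2 then h $ U3 else if q = U3 then h $ U2 else h $ q)"
  "gen_act W4 h $ q = (if q = U3 then h $ U4 else if q = U4 then h $ U3 else h $ q)"
  "gen_act W5 h $ q = (if q = U4 then h $ U5 else if q = U5 then h $ U4 else h $ q)"
  "gen_act W6 h $ q = (if q = U5 then h $ U6 else if q = U6 then h $ U5 else h $ q)"
  "gen_act W7 h $ q = (if q = U6 then h $ U7 else if q = U7 then h $ U6 else h $ q)"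
  "gen_act W8 h $ q = (if q = U1 then h $ U2 else if q = U2 then h $ U1 else h $ q)"
  by (cases q; simp add: gen_act_def lin_ext_nth axis_def field_simps)+

lemma word_act_relation: "word_act (concat (replicate (cox_order i j) [i, j])) h = h"
proof -
  have 1: "concat (replicate (Suc 0) [i, j]) = [i, j]"
    and 2: "concat (replicate 2 [i, j]) = [i, j, i, j]"
    and 3: "concat (replicate 3 [i, j]) = [i, j, i, j, i, j]" for i j :: gen
    by (simp_all add: numeral_2_eq_2 numeral_3_eq_3)
  show ?thesis
    by (rule form_eqI; cases i; cases j)
      (simp_all add: cox_order_def bonds_def 1 2 3 word_act_def gen_act_nth,
       simp_all add: field_simps)
qed

lemma word_act_append: "word_act (x @ y) h = word_act x (word_act y h)"
  by (simp add: word_act_def)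

lift_definition act :: "weyl \<Rightarrow> form \<Rightarrow> form" is word_act
proof -
  fix x y assume "cox_eq x y"
  then have "word_act x h = word_act y h" for h
  proof (induction arbitrary: h rule: cox_eq.induct)
    case (relation i j)
    then show ?case by (simp only: word_act_relation) (simp add: word_act_def)
  qed (simp_all add: word_act_append)
  then show "word_act x = word_act y" by blast
qed

lemma act_mult: "act (x \<otimes>\<^bsub>WE8\<^esub> y) h = act x (act y h)"
  unfolding WE8_def by (simp, transfer, rule word_act_append)

lemma act_one: "act \<one>\<^bsub>WE8\<^esub> h = h"
  unfolding WE8_def by (simp, transfer, simp add: word_act_def)

lemma act_generator: "act (w i) (X p) = gen_image i p"
  by transfer (simp add: word_act_def gen_act_def)

text \<open>Substitution of $u_2 = u_1$, $u_4 = u_3$, $u_6 = u_5$, $u_8 = u_7$ in a linear form.\<close>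

definition specialize :: "form \<Rightarrow> form" where
  "specialize = lin_ext (X(U2 := X U1, U4 := X U3, U6 := X U5, U8 := X U7))"

definition Omega :: "weyl set" where
  "Omega = {\<rho> \<in> carrier WE8.
     specialize (act \<rho> (X U1)) = specialize (act \<rho> (X U2)) \<and>
     specialize (act \<rho> (X U3)) = specialize (act \<rho> (X U4)) \<and>
     specialize (act \<rho> (X U5)) = specialize (act \<rho> (X U6)) \<and>
     specialize (act \<rho> (X U7)) = specialize (act \<rho> (X U8))}"

definition r1 :: weyl where
  "r1 = w W3 \<otimes>\<^bsub>WE8\<^esub> w W4 \<otimes>\<^bsub>WE8\<^esub> w W8 \<otimes>\<^bsub>WE8\<^esub> w W3"

definition r2 :: weyl where
  "r2 = w W5 \<otimes>\<^bsub>WE8\<^esub> w W4 \<otimes>\<^bsub>WE8\<^esub> w W6 \<otimes>\<^bsub>WE8\<^esub> w W5"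

definition r3 :: weyl where
  "r3 = w W7 \<otimes>\<^bsub>WE8\<^esub> w W6 \<otimes>\<^bsub>WE8\<^esub> w W0 \<otimes>\<^bsub>WE8\<^esub> w W7"

end

theory Submission
  imports Defs
begin

text \<open>
  The representation on linear forms is the geometric representation of the Coxeter group, and
  \<open>Omega\<close> is the stabiliser of the kernel of the specialisation, which is the span of the simple
  roots indexed by \<open>J = {0, 4, 6, 8}\<close>. By Tits' theorem, \<open>\<rho>\<close> sends the simple root of \<open>s\<close> to a nonnegative combination of
  simple roots unless \<open>\<rho> w\<^sub>s\<close> is shorter than \<open>\<rho>\<close>. Let \<open>\<rho> \<noteq> 1\<close> be in \<open>Omega\<close> and let \<open>\<rho> w\<^sub>a\<close> be shorter
  than \<open>\<rho>\<close>. If \<open>a\<close> is not \<open>3\<close>, \<open>5\<close>, \<open>7\<close>, then \<open>w\<^sub>a\<close> is one of the generators. Otherwise we may assume that \<open>\<rho>\<close>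
  sends the roots of \<open>J\<close> to nonnegative forms, and the neighbours \<open>j\<close>, \<open>k\<close> of \<open>a\<close> in \<open>J\<close> give the
  generator \<open>w\<^sub>a w\<^sub>j w\<^sub>k w\<^sub>a\<close>. The image of \<open>\<alpha>\<^sub>a + \<alpha>\<^sub>j\<close> cannot be nonnegative, since this would put the
  image of \<open>\<alpha>\<^sub>a\<close>, hence \<open>\<alpha>\<^sub>a\<close> itself, into the span; the same holds for \<open>k\<close>. So multiplication of
  \<open>\<rho>\<close> by \<open>w\<^sub>a\<close>, \<open>w\<^sub>j\<close>, \<open>w\<^sub>k\<close> shortens each time, and \<open>\<rho> w\<^sub>a w\<^sub>j w\<^sub>k w\<^sub>a\<close> is shorter than \<open>\<rho>\<close>.
\<close>

section \<open>Coxeter relations in the group\<close>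

interpretation WE8: group WE8
  by (rule group_WE8)

abbreviation weyl_prod :: "weyl \<Rightarrow> weyl \<Rightarrow> weyl" (infixl "\<odot>" 70) where
  "x \<odot> y \<equiv> x \<otimes>\<^bsub>WE8\<^esub> y"

lemma carrier_WE8 [simp]: "x \<in> carrier WE8"
  by (simp add: WE8_def)

lemma abs_weyl_append: "abs_weyl (x @ y) = abs_weyl x \<odot> abs_weyl y"
  by (simp add: WE8_def weyl_mult.abs_eq)

lemma abs_weyl_Nil: "abs_weyl [] = \<one>\<^bsub>WE8\<^esub>"
  by (simp add: WE8_def weyl_one.abs_eq)

lemma abs_weyl_single: "abs_weyl [s] = w s"
  by (simp add: w.abs_eq)

lemma w_relation: "abs_weyl (concat (replicate (cox_order s t) [s, t])) = \<one>\<^bsub>WE8\<^esub>"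
  using cox_eq.relation weyl.abs_eq_iff by (simp flip: abs_weyl_Nil)

lemma w_square: "w s \<odot> w s = \<one>\<^bsub>WE8\<^esub>"
  using w_relation[of s s] abs_weyl_append[of "[s]" "[s]"]
  by (simp add: cox_order_def abs_weyl_single)

lemma mult_w_w [simp]: "x \<odot> w s \<odot> w s = x"
  by (simp add: WE8.m_assoc w_square)

lemma mult_w_eq_iff: "x \<odot> w s = y \<longleftrightarrow> x = y \<odot> w s"
  by auto

text \<open>The prefix \<open>x\<close> lets the relation rewrite the last letters of any
  left-associated product.\<close>

lemma w_commute:
  assumes "cox_order s t = 2"
  shows "x \<odot> w s \<odot> w t = x \<odot> w t \<odot> w s"
proof -
  have "abs_weyl ([s] @ [t] @ [s] @ [t]) = \<one>\<^bsub>WE8\<^esub>"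
    using w_relation[of s t] assms by (simp add: numeral_2_eq_2)
  then have "w s \<odot> w t \<odot> w s \<odot> w t = \<one>\<^bsub>WE8\<^esub>"
    by (simp only: abs_weyl_append abs_weyl_single) (simp add: WE8.m_assoc)
  then have "x \<odot> (w s \<odot> w t \<odot> w s \<odot> w t) = x"
    by simp
  then have "x \<odot> w s \<odot> w t \<odot> w s \<odot> w t = x"
    by (simp add: WE8.m_assoc)
  then show ?thesis
    by (simp add: mult_w_eq_iff)
qed

lemma w_braid:
  assumes "cox_order s t = 3"
  shows "x \<odot> w s \<odot> w t \<odot> w s = x \<odot> w t \<odot> w s \<odot> w t"
proof -
  have "abs_weyl ([s] @ [t] @ [s] @ [t] @ [s] @ [t]) = \<one>\<^bsub>WE8\<^esub>"
    using w_relation[of s t] assms by (simp add: numeral_3_eq_3)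
  then have "w s \<odot> w t \<odot> w s \<odot> w t \<odot> w s \<odot> w t = \<one>\<^bsub>WE8\<^esub>"
    by (simp only: abs_weyl_append abs_weyl_single) (simp add: WE8.m_assoc)
  then have "x \<odot> (w s \<odot> w t \<odot> w s \<odot> w t \<odot> w s \<odot> w t) = x"
    by simp
  then have "x \<odot> w s \<odot> w t \<odot> w s \<odot> w t \<odot> w s \<odot> w t = x"
    by (simp add: WE8.m_assoc)
  then show ?thesis
    by (simp add: mult_w_eq_iff)
qed

section \<open>Word length and right descents\<close>

definition len :: "weyl \<Rightarrow> nat" where
  "len \<rho> = (LEAST n. \<exists>x. length x = n \<and> abs_weyl x = \<rho>)"

lemma len_le: "len (abs_weyl x) \<le> length x"
  unfolding len_def by (rule Least_le) auto

lemma reduced_word: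
  obtains x where "length x = len \<rho>" "abs_weyl x = \<rho>"
proof -
  have "\<exists>n x. length x = n \<and> abs_weyl x = \<rho>"
    by (induction \<rho> rule: weyl.abs_induct) blast
  then have "\<exists>x. length x = len \<rho> \<and> abs_weyl x = \<rho>"
    unfolding len_def by (rule LeastI_ex)
  then show ?thesis
    using that by blast
qed

lemma len_mult_w_le: "len (\<rho> \<odot> w s) \<le> Suc (len \<rho>)"
proof -
  obtain x where "length x = len \<rho>" "abs_weyl x = \<rho>"
    by (rule reduced_word)
  then show ?thesis
    using len_le[of "x @ [s]"] by (simp add: abs_weyl_append abs_weyl_single)
qed

text \<open>The last letter of a reduced word for \<open>\<rho>\<close> serves as
  \<open>s\<close>.\<close>

lemma right_descent:
  assumes "\<rho> \<noteq> \<one>\<^bsub>WE8\<^esub>"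
  obtains s where "len (\<rho> \<odot> w s) < len \<rho>"
proof -
  obtain x where x: "length x = len \<rho>" "abs_weyl x = \<rho>"
    by (rule reduced_word)
  with assms have "x \<noteq> []"
    using abs_weyl_Nil by auto
  then obtain y s where y: "x = y @ [s]"
    by (metis rev_exhaust)
  then have "\<rho> \<odot> w s = abs_weyl y"
    using x by (simp add: abs_weyl_append abs_weyl_single mult_w_eq_iff)
  with len_le[of y] x(1) y show ?thesis
    by (intro that[of s]) simp
qed

section \<open>Simple roots and their coordinates\<close>

primrec root :: "gen \<Rightarrow> form" where
  "root W0 = X U7 - X U8"
| "root W1 = 4 *\<^sub>R X B"
| "root W2 = - beta"
| "root W3 = X U2 - X U3"
| "root W4 = X U3 - X U4"
| "root W5 = X U4 - X U5"
| "root W6 = X U5 - X U6"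
| "root W7 = X U6 - X U7"
| "root W8 = X U1 - X U2"

text \<open>The coordinates of a form with respect to the basis \<^const>\<open>root\<close>.\<close>

primrec coord :: "gen \<Rightarrow> form \<Rightarrow> real" where
  "coord W0 h = - h$U8"
| "coord W1 h = (h$B - (h$U1 + h$U2 + h$U3 + h$U4 + h$U5 + h$U6 + h$U7 + h$U8)) / 4"
| "coord W2 h = - (h$U1 + h$U2 + h$U3 + h$U4 + h$U5 + h$U6 + h$U7 + h$U8) / 2"
| "coord W3 h = - (h$U3 + h$U4 + h$U5 + h$U6 + h$U7 + h$U8)"
| "coord W4 h = - (h$U4 + h$U5 + h$U6 + h$U7 + h$U8)"
| "coord W5 h = - (h$U5 + h$U6 + h$U7 + h$U8)"
| "coord W6 h = - (h$U6 + h$U7 + h$U8)"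
| "coord W7 h = - (h$U7 + h$U8)"
| "coord W8 h = (h$U1 - (h$U2 + h$U3 + h$U4 + h$U5 + h$U6 + h$U7 + h$U8)) / 2"

definition nonneg :: "form \<Rightarrow> bool" where
  "nonneg h \<longleftrightarrow> (\<forall>i. 0 \<le> coord i h)"

lemma coord_root: "coord i (root j) = (if i = j then 1 else 0)"
  by (cases i; cases j) (simp_all add: axis_def)

lemma coord_add: "coord i (h + k) = coord i h + coord i k"
  by (cases i) (simp_all add: field_simps)

lemma coord_minus: "coord i (- h) = - coord i h"
  by (cases i) (simp_all add: field_simps)

lemma coord_eq_0:
  assumes "\<And>i. coord i h = 0"
  shows "h = 0"
  using assms[of W0] assms[of W1] assms[of W2] assms[of W3] assms[of W4] assms[of W5]
    assms[of W6] assms[of W7] assms[of W8]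
  by (intro form_eqI) simp_all

lemma nonneg_root: "nonneg (root s)"
  by (simp add: nonneg_def coord_root)

lemma root_neq_0: "root s \<noteq> 0"
proof
  assume "root s = 0"
  then have "coord s (root s) = coord s 0"
    by simp
  also have "coord s 0 = 0"
    by (cases s) simp_all
  finally show False
    by (simp add: coord_root)
qed

lemma nonneg_add: "nonneg h \<Longrightarrow> nonneg k \<Longrightarrow> nonneg (h + k)"
  by (simp add: nonneg_def coord_add)

lemma nonneg_antisym:
  assumes "nonneg h" "nonneg (- h)"
  shows "h = 0"
proof (rule coord_eq_0)
  fix i
  have "0 \<le> coord i h" "0 \<le> coord i (- h)"
    using assms by (auto simp: nonneg_def)
  then show "coord i h = 0"
    by (simp add: coord_minus)
qed

section \<open>Action on the simple roots and Tits' theorem\<close>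

lemma linear_act: "linear (act \<rho>)"
proof (induction \<rho> rule: weyl.abs_induct)
  case (1 x)
  have "linear (word_act x)"
  proof (induction x)
    case Nil
    show ?case by (rule linearI) (simp_all add: word_act_def)
  next
    case (Cons i x)
    have "linear (gen_act i \<circ> word_act x)"
      using Cons by (intro linear_compose) (simp_all add: gen_act_def linear_lin_ext)
    then show ?case by (simp add: word_act_def comp_def)
  qed
  then show ?case by (simp add: act.abs_eq)
qed

lemma act_inv [simp]: "act (inv\<^bsub>WE8\<^esub> \<rho>) (act \<rho> h) = h"
  by (simp add: act_one flip: act_mult)

lemma inj_act: "inj (act \<rho>)"
  by (metis act_inv injI)

lemma act_w: "act (w s) h = gen_act s h"
  by (simp add: w.abs_eq act.abs_eq word_act_def)

lemma gen_act_root_self: "gen_act s (root s) = - root s"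
  by (rule form_eqI; cases s) (simp_all add: gen_act_nth axis_def)

lemma gen_act_root_2: "cox_order s t = 2 \<Longrightarrow> gen_act s (root t) = root t"
  by (rule form_eqI; cases s; cases t)
    (simp_all add: cox_order_def bonds_def gen_act_nth axis_def)

text \<open>The factor 4 in \<open>root W1\<close> and the sign of \<open>root W2\<close> are chosen
  so that every bond gives this same formula.\<close>

lemma gen_act_root_3: "cox_order s t = 3 \<Longrightarrow> gen_act s (root t) = root s + root t"
  by (rule form_eqI; cases s; cases t)
    (simp_all add: cox_order_def bonds_def gen_act_nth axis_def)

lemma act_mult_w: "act (\<rho> \<odot> w s) h = act \<rho> (gen_act s h)"
  by (simp add: act_mult act_w)

lemma act_mult_root_self: "act (\<rho> \<odot> w s) (root s) = - act \<rho> (root s)"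
  by (simp add: act_mult_w gen_act_root_self linear_neg linear_act)

lemma act_mult_root_2: "cox_order s t = 2 \<Longrightarrow> act (\<rho> \<odot> w s) (root t) = act \<rho> (root t)"
  by (simp add: act_mult_w gen_act_root_2)

lemma act_mult_root_3:
  "cox_order s t = 3 \<Longrightarrow> act (\<rho> \<odot> w s) (root t) = act \<rho> (root s) + act \<rho> (root t)"
  by (simp add: act_mult_w gen_act_root_3 linear_add linear_act)

lemma cox_order_cases:
  assumes "s \<noteq> t"
  obtains "cox_order s t = 2" | "cox_order s t = 3"
  using assms unfolding cox_order_def by (cases "(s, t) \<in> bonds \<or> (t, s) \<in> bonds") simp_all

lemma cox_order_commute: "cox_order s t = cox_order t s"
  by (auto simp: cox_order_def)

text \<open>Tits' theorem: only rank two subgroups of order at most \<open>6\<close> occur, so the usual passage to a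
  minimal coset representative becomes a case distinction.\<close>

theorem nonneg_act_root:
  assumes "len \<rho> \<le> len (\<rho> \<odot> w s)"
  shows "nonneg (act \<rho> (root s))"
  using assms
proof (induction "len \<rho>" arbitrary: \<rho> s rule: less_induct)
  case less
  show ?case
  proof (cases "\<rho> = \<one>\<^bsub>WE8\<^esub>")
    case True
    then show ?thesis by (simp add: act_one nonneg_root)
  next
    case False
    then obtain t where t: "len (\<rho> \<odot> w t) < len \<rho>"
      by (rule right_descent)
    define v where "v = \<rho> \<odot> w t"
    have \<rho>: "\<rho> = v \<odot> w t"
      by (simp add: v_def)
    have v: "len v < len \<rho>"
      using t by (simp add: v_def)
    from t less.prems have "t \<noteq> s"
      by auto
    then show ?thesis
    proof (cases rule: cox_order_cases)
      case 1
      have "\<rho> \<odot> w s = v \<odot> w s \<odot> w t"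
        unfolding \<rho> using 1 by (rule w_commute)
      then have "len v \<le> len (v \<odot> w s)"
        using len_mult_w_le[of "v \<odot> w s" t] less.prems v by simp
      with less.hyps v have "nonneg (act v (root s))"
        by blast
      then show ?thesis
        using 1 by (simp add: \<rho> act_mult_root_2)
    next
      case 2
      show ?thesis
      proof (cases "len v \<le> len (v \<odot> w s)")
        case True
        with less.hyps v have "nonneg (act v (root s))"
          by blast
        \<comment> \<open>The induction hypothesis applies to \<open>t\<close> because
          \<open>v \<odot> w t\<close> is \<open>\<rho>\<close>, which is longer than
          \<open>v\<close>.\<close>
        moreover have "nonneg (act v (root t))"
          using less.hyps v \<rho> by simp
        ultimately show ?thesis
          using 2 by (simp add: \<rho> act_mult_root_3 nonneg_add)
      next
        case False
        define u where "u = v \<odot> w s"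
        have v_eq: "v = u \<odot> w s"
          by (simp add: u_def)
        have u: "len u < len v"
          using False by (simp add: u_def)
        \<comment> \<open>Here \<open>\<rho>\<close> is \<open>u \<odot> w s \<odot> w t\<close> and
          \<open>len u + 2 \<le> len \<rho>\<close>. After the braid move, a descent of
          \<open>u\<close> at \<open>t\<close> would make \<open>\<rho> \<odot> w s\<close> shorter
          than \<open>\<rho>\<close>.\<close>
        have "\<rho> \<odot> w s = u \<odot> w t \<odot> w s \<odot> w t"
          unfolding \<rho> v_eq using 2 by (subst w_braid) (simp_all add: cox_order_commute)
        then have "len (\<rho> \<odot> w s) \<le> len (u \<odot> w t) + 2"
          using len_mult_w_le[of "u \<odot> w t" s] len_mult_w_le[of "u \<odot> w t \<odot> w s" t] by simp
        then have "len u \<le> len (u \<odot> w t)"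
          using less.prems u v by simp
        with less.hyps u v have "nonneg (act u (root t))"
          by simp
        moreover have "act \<rho> (root s) = act u (root t)"
          using 2 by (simp add: \<rho> v_eq act_mult_root_3 act_mult_root_self cox_order_commute)
        ultimately show ?thesis
          by simp
      qed
    qed
  qed
qed

lemma nonneg_minus_act_root:
  assumes "len (\<rho> \<odot> w s) < len \<rho>"
  shows "nonneg (- act \<rho> (root s))"
  using nonneg_act_root[of "\<rho> \<odot> w s" s] assms by (simp add: act_mult_root_self)

section \<open>Kernel of the specialisation and its stabiliser\<close>

definition kernel :: "form set" where
  "kernel = {h. specialize h = 0}"

lemma linear_specialize: "linear specialize"
  by (simp add: specialize_def linear_lin_ext)

lemma subspace_kernel: "subspace kernel"
  unfolding kernel_def using linear_specialize by (rule linear_subspace_kernel)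

lemma kernel_iff_nth:
  "h \<in> kernel \<longleftrightarrow> h$U1 + h$U2 = 0 \<and> h$U3 + h$U4 = 0 \<and> h$U5 + h$U6 = 0 \<and> h$U7 + h$U8 = 0 \<and> h$B = 0"
proof
  assume "h \<in> kernel"
  then have "specialize h $ p = 0" for p
    by (simp add: kernel_def)
  from this[of U1] this[of U3] this[of U5] this[of U7] this[of B]
  show "h$U1 + h$U2 = 0 \<and> h$U3 + h$U4 = 0 \<and> h$U5 + h$U6 = 0 \<and> h$U7 + h$U8 = 0 \<and> h$B = 0"
    by (simp add: specialize_def lin_ext_nth axis_def)
next
  assume "h$U1 + h$U2 = 0 \<and> h$U3 + h$U4 = 0 \<and> h$U5 + h$U6 = 0 \<and> h$U7 + h$U8 = 0 \<and> h$B = 0"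
  then show "h \<in> kernel"
    unfolding kernel_def mem_Collect_eq
    by (intro form_eqI) (simp_all add: specialize_def lin_ext_nth axis_def)
qed

text \<open>The five indices form the complement of \<open>J\<close>, so the kernel is the span of
  the roots of \<open>J\<close>.\<close>

lemma kernel_iff_coord: "h \<in> kernel \<longleftrightarrow> (\<forall>i\<in>{W1, W2, W3, W5, W7}. coord i h = 0)"
  unfolding kernel_iff_nth by (simp; linarith)

lemma kernel_decomp:
  assumes "h \<in> kernel"
  shows "h = h$U1 *\<^sub>R root W8 + h$U3 *\<^sub>R root W4 + h$U5 *\<^sub>R root W6 + h$U7 *\<^sub>R root W0"
  using assms unfolding kernel_iff_nth by (intro form_eqI) (simp_all add: axis_def)

lemma Omega_iff_roots: "\<rho> \<in> Omega \<longleftrightarrow> (\<forall>j\<in>{W0, W4, W6, W8}. act \<rho> (root j) \<in> kernel)"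
  by (auto simp: Omega_def kernel_def linear_diff[OF linear_act] linear_diff[OF linear_specialize])

lemma Omega_iff: "\<rho> \<in> Omega \<longleftrightarrow> (\<forall>h. act \<rho> h \<in> kernel \<longleftrightarrow> h \<in> kernel)"
proof
  assume "\<rho> \<in> Omega"
  then have roots: "act \<rho> (root j) \<in> kernel" if "j \<in> {W0, W4, W6, W8}" for j
    using that Omega_iff_roots by blast
  have "act \<rho> h \<in> kernel" if "h \<in> kernel" for h
  proof -
    have "act \<rho> h = h$U1 *\<^sub>R act \<rho> (root W8) + h$U3 *\<^sub>R act \<rho> (root W4)
        + h$U5 *\<^sub>R act \<rho> (root W6) + h$U7 *\<^sub>R act \<rho> (root W0)"
      by (subst kernel_decomp[OF that])
        (simp only: linear_add[OF linear_act] linear_scale[OF linear_act])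
    also have "\<dots> \<in> kernel"
      by (intro subspace_add subspace_scale subspace_kernel roots) simp_all
    finally show ?thesis .
  qed
  then have "act \<rho> ` kernel \<subseteq> kernel"
    by blast
  \<comment> \<open>An injective linear map preserves dimension, so the inclusion is an equality and
    membership is also reflected.\<close>
  moreover have "dim (act \<rho> ` kernel) = dim kernel"
    using inj_act inj_on_subset by (intro dim_image_eq linear_act) blast
  ultimately have "act \<rho> ` kernel = kernel"
    by (intro subspace_dim_equal linear_subspace_image linear_act subspace_kernel) simp_all
  then show "\<forall>h. act \<rho> h \<in> kernel \<longleftrightarrow> h \<in> kernel"
    using inj_act[of \<rho>] by (metis inj_image_mem_iff)
next
  assume "\<forall>h. act \<rho> h \<in> kernel \<longleftrightarrow> h \<in> kernel"
  moreover have "root j \<in> kernel" if "j \<in> {W0, W4, W6, W8}" for j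
    using that by (auto simp: kernel_iff_coord coord_root)
  ultimately show "\<rho> \<in> Omega"
    by (simp add: Omega_iff_roots)
qed

lemma subgroup_Omega: "subgroup Omega WE8"
proof
  show "\<one>\<^bsub>WE8\<^esub> \<in> Omega"
    by (simp add: Omega_iff act_one)
  show "x \<odot> y \<in> Omega" if "x \<in> Omega" "y \<in> Omega" for x y
    using that by (simp add: Omega_iff act_mult)
  show "inv\<^bsub>WE8\<^esub> x \<in> Omega" if "x \<in> Omega" for x
    using that act_inv[of "inv\<^bsub>WE8\<^esub> x"] by (metis Omega_iff WE8.inv_inv carrier_WE8)
qed auto

section \<open>Generators and descent inside the stabiliser\<close>

definition Omega_gens :: "weyl set" where
  "Omega_gens = {w W0, w W1, w W2, r1, w W4, r2, w W6, r3, w W8}"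

text \<open>Each single letter listed fixes every root of \<open>J\<close> up to sign, while
  \<open>r1\<close>, \<open>r2\<close>, \<open>r3\<close> interchange neighbouring pairs among
  \<open>(U1, U2)\<close>, \<open>(U3, U4)\<close>, \<open>(U5, U6)\<close>,
  \<open>(U7, U8)\<close>.\<close>

lemma Omega_gens_subset: "Omega_gens \<subseteq> Omega"
  by (auto simp: Omega_gens_def Omega_iff_roots kernel_iff_nth r1_def r2_def r3_def
      act_mult act_w gen_act_nth axis_def)

text \<open>The nonnegative form \<open>act \<rho> (root j)\<close> of the kernel dominates \<open>- act \<rho> (root a)\<close> if the sum
  of the two images is nonnegative.\<close>

lemma not_nonneg_act_sum:
  assumes \<rho>: "\<rho> \<in> Omega"
    and a: "a \<in> {W3, W5, W7}" "nonneg (- act \<rho> (root a))"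
    and j: "j \<in> {W0, W4, W6, W8}"
  shows "\<not> nonneg (act \<rho> (root a) + act \<rho> (root j))"
proof
  assume sum: "nonneg (act \<rho> (root a) + act \<rho> (root j))"
  have ker: "act \<rho> (root j) \<in> kernel"
    using \<rho> j by (auto simp: Omega_iff_roots)
  \<comment> \<open>Outside \<open>J\<close> the image of \<open>root j\<close> contributes nothing,
    so the two sign conditions squeeze the coordinate to zero.\<close>
  have "coord i (act \<rho> (root a)) = 0" if "i \<in> {W1, W2, W3, W5, W7}" for i
  proof -
    have "coord i (act \<rho> (root j)) = 0"
      using ker that unfolding kernel_iff_coord by blast
    moreover have "0 \<le> - coord i (act \<rho> (root a))"
      "0 \<le> coord i (act \<rho> (root a)) + coord i (act \<rho> (root j))"
      using a(2) sum by (simp_all add: nonneg_def coord_add coord_minus)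
    ultimately show ?thesis
      by simp
  qed
  then have "act \<rho> (root a) \<in> kernel"
    unfolding kernel_iff_coord by blast
  then have "root a \<in> kernel"
    using \<rho> by (simp add: Omega_iff)
  then show False
    using a(1) by (auto simp: kernel_iff_coord coord_root)
qed

lemma len_mult_swap_less:
  assumes \<rho>: "\<rho> \<in> Omega"
    and a: "a \<in> {W3, W5, W7}" "len (\<rho> \<odot> w a) < len \<rho>"
    and jk: "j \<in> {W0, W4, W6, W8}" "k \<in> {W0, W4, W6, W8}"
      "cox_order a j = 3" "cox_order a k = 3" "cox_order j k = 2"
  shows "len (\<rho> \<odot> (w a \<odot> w j \<odot> w k \<odot> w a)) < len \<rho>"
proof -
  have neg: "nonneg (- act \<rho> (root a))"
    using a(2) by (rule nonneg_minus_act_root)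
  have "act (\<rho> \<odot> w a) (root j) = act \<rho> (root a) + act \<rho> (root j)"
    using jk by (simp add: act_mult_root_3)
  then have "len (\<rho> \<odot> w a \<odot> w j) < len (\<rho> \<odot> w a)"
    using not_nonneg_act_sum[OF \<rho> a(1) neg jk(1)] nonneg_act_root not_less by metis
  \<comment> \<open>As \<open>j\<close> and \<open>k\<close> commute, \<open>w j\<close> fixes
    \<open>root k\<close>, which reduces this to the same sum for \<open>k\<close>.\<close>
  moreover have "act (\<rho> \<odot> w a \<odot> w j) (root k) = act \<rho> (root a) + act \<rho> (root k)"
    using jk by (simp add: act_mult_root_2 act_mult_root_3)
  then have "len (\<rho> \<odot> w a \<odot> w j \<odot> w k) < len (\<rho> \<odot> w a \<odot> w j)"
    using not_nonneg_act_sum[OF \<rho> a(1) neg jk(2)] nonneg_act_root not_less by metis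
  \<comment> \<open>The final \<open>w a\<close> may lengthen, but by at most one against three
    drops.\<close>
  moreover have "len (\<rho> \<odot> w a \<odot> w j \<odot> w k \<odot> w a) \<le> Suc (len (\<rho> \<odot> w a \<odot> w j \<odot> w k))"
    by (rule len_mult_w_le)
  ultimately show ?thesis
    using a(2) by (simp add: WE8.m_assoc)
qed

lemma Omega_descent:
  assumes \<rho>: "\<rho> \<in> Omega" "\<rho> \<noteq> \<one>\<^bsub>WE8\<^esub>"
  obtains g where "g \<in> Omega_gens" "len (\<rho> \<odot> g) < len \<rho>"
proof -
  obtain a where a: "len (\<rho> \<odot> w a) < len \<rho>"
    using \<rho>(2) by (rule right_descent)
  note swap = len_mult_swap_less[OF \<rho>(1) _ a]
  show ?thesis
  proof (cases a)
    case W3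
    then show ?thesis
      using swap[of W4 W8] that[of r1]
      by (simp add: Omega_gens_def r1_def cox_order_def bonds_def)
  next
    case W5
    then show ?thesis
      using swap[of W4 W6] that[of r2]
      by (simp add: Omega_gens_def r2_def cox_order_def bonds_def)
  next
    case W7
    then show ?thesis
      using swap[of W6 W0] that[of r3]
      by (simp add: Omega_gens_def r3_def cox_order_def bonds_def)
  \<comment> \<open>In the other six cases \<open>w a\<close> itself is a generator.\<close>
  qed (use a that in \<open>auto simp: Omega_gens_def\<close>)
qed

lemma Omega_subset_generate: "\<rho> \<in> Omega \<Longrightarrow> \<rho> \<in> generate WE8 Omega_gens"
proof (induction "len \<rho>" arbitrary: \<rho> rule: less_induct)
  case less
  show ?case
  proof (cases "\<rho> = \<one>\<^bsub>WE8\<^esub>")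
    case True
    then show ?thesis by (simp add: generate.one)
  next
    case False
    with less.prems obtain g where g: "g \<in> Omega_gens" "len (\<rho> \<odot> g) < len \<rho>"
      by (rule Omega_descent)
    have "\<rho> \<odot> g \<in> Omega"
      using g(1) less.prems Omega_gens_subset subgroup.m_closed[OF subgroup_Omega] by blast
    with less.hyps g(2) have "\<rho> \<odot> g \<in> generate WE8 Omega_gens"
      by blast
    then have "\<rho> \<odot> g \<odot> inv\<^bsub>WE8\<^esub> g \<in> generate WE8 Omega_gens"
      using g(1) by (rule generate.eng[OF _ generate.inv])
    also have "\<rho> \<odot> g \<odot> inv\<^bsub>WE8\<^esub> g = \<rho>"
      by (simp add: WE8.m_assoc)
    finally show ?thesis .
  qed
qed

theorem lemma3p1:
  shows "Omega = generate WE8 {w W0, w W1, w W2, r1, w W4, r2, w W6, r3, w W8}"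
proof -
  have "generate WE8 Omega_gens \<subseteq> Omega"
    using Omega_gens_subset subgroup_Omega by (rule WE8.generate_subgroup_incl)
  then show ?thesis
    using Omega_subset_generate by (auto simp: Omega_gens_def)
qed

end
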